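(* Let $X$ be a Tychonoff space, and let $z\in\beta X$. Then: (i) $z\in\upsilon X$ if, and only if, $\delta_z$ is bounded on each compact subset of $C_p^b(X)$; (ii) $z\in\kappa X$ if, and only if, the restriction of $\delta_z$ to each compact subset of $C_p^b(X)$ is continuous.
   Context: For a Tychonoff space $X$, $C_p(X)$ is the set $C(X)$ of all continuous real-valued functions on $X$ with the topology of pointwise convergence, and $C_p^b(X)\subseteq C_p(X)$ is the subspace of all bounded continuous functions. $\beta X$ is the Stone–Čech compactification of $X$, and $\upsilon X$ is the (Hewitt) realcompactification of $X$, viewed as a subspace $X\subseteq\upsilon X\subseteq\beta X$ (the smallest realcompact subspace of $\beta X$ containing $X$). For $z\in\beta X$, $\delta_z$ is the functional on $C_p^b(X)$ given by $\delta_z(f):=\bar f(z)$, where $\bar f$ is the unique continuous real-valued extension of the bounded function $f$ to $\beta X$. A Tychonoff space is called a $\kappa$-space if it is homeomorphic to a closed subspace of $C_p(Y)$ for some locally compact (Hausdorff) space $Y$. The $\kappa$-completion $\kappa X$ of $X$ is the intersection of all subspaces of $\beta X$ that contain $X$ and are $\kappa$-spaces. *)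

theory Defs
  imports "HOL-Analysis.Analysis"
begin

section \<open>Function spaces with the pointwise topology\<close>

definition tychonoff_space :: "'a topology \<Rightarrow> bool" where
  "tychonoff_space X \<longleftrightarrow> completely_regular_space X \<and> Hausdorff_space X"

abbreviation real_power :: "'i set \<Rightarrow> ('i \<Rightarrow> real) topology" where
  "real_power I \<equiv> product_topology (\<lambda>_. euclideanreal) I"

text \<open>A function on \<open>X\<close> is represented by its unique representative in
  \<open>extensional (topspace X)\<close>, so that \<open>C(X)\<close> is literally a subset of the power
  \<open>real_power (topspace X)\<close> and carries the subspace topology.\<close>

definition Cp :: "'a topology \<Rightarrow> ('a \<Rightarrow> real) topology" where
  "Cp X = subtopology (real_power (topspace X)) {f. continuous_map X euclideanreal f}"

definition Cpb :: "'a topology \<Rightarrow> ('a \<Rightarrow> real) topology" where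
  "Cpb X = subtopology (Cp X) {f. bounded (f ` topspace X)}"

lemma topspace_Cp:
  "topspace (Cp X) = {f \<in> extensional (topspace X). continuous_map X euclideanreal f}"
  by (auto simp: Cp_def PiE_def)

lemma topspace_Cpb:
  "topspace (Cpb X) =
     {f \<in> extensional (topspace X). continuous_map X euclideanreal f \<and> bounded (f ` topspace X)}"
  by (auto simp: Cpb_def topspace_Cp)


section \<open>The Stone--Cech compactification\<close>

text \<open>\<open>\<beta>X\<close> is the closure of the canonical image of \<open>X\<close> in the cube whose
  coordinates are the continuous functions from \<open>X\<close> to \<open>[0,1]\<close>.\<close>

definition unit_functions :: "'a topology \<Rightarrow> ('a \<Rightarrow> real) set" where
  "unit_functions X = {f \<in> extensional (topspace X). continuous_map X (top_of_set {0..1}) f}"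

definition sc_map :: "'a topology \<Rightarrow> 'a \<Rightarrow> ('a \<Rightarrow> real) \<Rightarrow> real" where
  "sc_map X x = (\<lambda>f \<in> unit_functions X. f x)"

definition stone_cech :: "'a topology \<Rightarrow> (('a \<Rightarrow> real) \<Rightarrow> real) topology" where
  "stone_cech X =
     (let Q = product_topology (\<lambda>_. top_of_set {0..1}) (unit_functions X)
      in subtopology Q (Q closure_of (sc_map X ` topspace X)))"

text \<open>The extension of a bounded continuous function to \<open>\<beta>X\<close>; existence and uniqueness
  are proved in \<open>sc_extension_unique\<close> below.\<close>

definition sc_extension :: "'a topology \<Rightarrow> ('a \<Rightarrow> real) \<Rightarrow> (('a \<Rightarrow> real) \<Rightarrow> real) \<Rightarrow> real" where
  "sc_extension X f =
     (THE g. g \<in> extensional (topspace (stone_cech X)) \<and>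
             continuous_map (stone_cech X) euclideanreal g \<and>
             (\<forall>x \<in> topspace X. g (sc_map X x) = f x))"

definition delta :: "'a topology \<Rightarrow> (('a \<Rightarrow> real) \<Rightarrow> real) \<Rightarrow> ('a \<Rightarrow> real) \<Rightarrow> real" where
  "delta X z f = sc_extension X f z"

lemma compact_space_stone_cech: "compact_space (stone_cech X)"
proof -
  let ?Q = "product_topology (\<lambda>_. top_of_set {0..1::real}) (unit_functions X)"
  have "compact_space ?Q"
    by (simp add: compact_space_product_topology compact_space_subtopology)
  then have "compactin ?Q (?Q closure_of (sc_map X ` topspace X))"
    by (simp add: closedin_compact_space)
  then show ?thesis
    by (simp add: stone_cech_def Let_def compact_space_subtopology)
qed

lemma Hausdorff_space_stone_cech: "Hausdorff_space (stone_cech X)"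
  by (simp add: stone_cech_def Let_def Hausdorff_space_subtopology Hausdorff_space_product_topology)

lemma sc_map_in_cube:
  "sc_map X ` topspace X \<subseteq>
     topspace (product_topology (\<lambda>_. top_of_set {0..1::real}) (unit_functions X))"
proof -
  have "f x \<in> {0..1}" if "x \<in> topspace X" "f \<in> unit_functions X" for f x
    using that unfolding unit_functions_def continuous_map_in_subtopology by blast
  then show ?thesis
    unfolding sc_map_def topspace_product_topology topspace_euclidean_subtopology image_subset_iff
    by (intro ballI restrict_PiE_iff [THEN iffD2]) simp
qed

lemma sc_map_in_stone_cech: "x \<in> topspace X \<Longrightarrow> sc_map X x \<in> topspace (stone_cech X)"
proof -
  let ?Q = "product_topology (\<lambda>_. top_of_set {0..1::real}) (unit_functions X)"
  assume x: "x \<in> topspace X"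
  have sub: "sc_map X ` topspace X \<subseteq> topspace ?Q"
    by (rule sc_map_in_cube)
  show ?thesis
    using x closure_of_subset [OF sub] sub by (auto simp: stone_cech_def Let_def)
qed

lemma embedding_map_sc_map:
  assumes "tychonoff_space X"
  shows "embedding_map X (stone_cech X) (sc_map X)"
proof -
  let ?Q = "product_topology (\<lambda>_. top_of_set {0..1::real}) (unit_functions X)"
  have U: "unit_functions X =
      mspace (submetric (cfunspace X euclidean_metric) {f. f \<in> topspace X \<rightarrow> {0..1}})"
    by (auto simp: unit_functions_def continuous_map_in_subtopology Met_TC.mbounded_def
        intro: bounded_subset [OF bounded_closed_interval])
  have "embedding_map X ?Q (sc_map X)"
    using completely_regular_space_cube_embedding_explicit [of X] assms
    unfolding tychonoff_space_def sc_map_def U by simp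
  moreover have "sc_map X ` topspace X \<subseteq> topspace (stone_cech X)"
    using sc_map_in_stone_cech by auto
  moreover have "topspace (stone_cech X) \<subseteq> ?Q closure_of (sc_map X ` topspace X)"
    by (auto simp: stone_cech_def Let_def)
  ultimately show ?thesis
    by (auto simp: stone_cech_def Let_def embedding_map_in_subtopology)
qed

lemma stone_cech_dense:
  "(stone_cech X) closure_of (sc_map X ` topspace X) = topspace (stone_cech X)"
proof -
  let ?Q = "product_topology (\<lambda>_. top_of_set {0..1::real}) (unit_functions X)"
  let ?S = "sc_map X ` topspace X"
  have "?S \<subseteq> topspace ?Q"
    by (rule sc_map_in_cube)
  then have "?S \<subseteq> ?Q closure_of ?S"
    by (rule closure_of_subset)
  then have "?Q closure_of ?S \<inter> ?S = ?S"
    by blast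
  then have "stone_cech X closure_of ?S = ?Q closure_of ?S"
    unfolding stone_cech_def Let_def closure_of_subtopology by (simp only: Int_absorb)
  moreover have "topspace (stone_cech X) = ?Q closure_of ?S"
    unfolding stone_cech_def Let_def topspace_subtopology
    using closure_of_subset_topspace by (rule inf.absorb2)
  ultimately show ?thesis
    by (simp only:)
qed

lemma sc_extension_unique:
  assumes "continuous_map X euclideanreal f" "bounded (f ` topspace X)"
  shows "\<exists>!g. g \<in> extensional (topspace (stone_cech X)) \<and>
             continuous_map (stone_cech X) euclideanreal g \<and>
             (\<forall>x \<in> topspace X. g (sc_map X x) = f x)"
proof -
  let ?B = "stone_cech X"
  obtain M where M: "M > 0" "\<And>x. x \<in> topspace X \<Longrightarrow> \<bar>f x\<bar> \<le> M"
    using assms(2) by (auto simp: bounded_pos)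
  define u where "u = (\<lambda>x \<in> topspace X. (f x + M) / (2 * M))"
  have "continuous_map X euclideanreal (\<lambda>x. (f x + M) / (2 * M))"
    using M assms(1) by (intro continuous_intros) auto
  then have "continuous_map X euclideanreal u"
    by (rule continuous_map_eq) (auto simp: u_def)
  moreover have "0 \<le> u x \<and> u x \<le> 1" if "x \<in> topspace X" for x
    using M(1) M(2)[OF that] that by (auto simp: u_def field_simps abs_le_iff)
  ultimately have u: "u \<in> unit_functions X"
    by (auto simp: unit_functions_def continuous_map_in_subtopology) (simp add: u_def)
  define g where "g = (\<lambda>w \<in> topspace ?B. w u * (2 * M) - M)"
  have "continuous_map ?B euclideanreal (\<lambda>w. w u)"
  proof -
    have "continuous_map ?B (top_of_set {0..1}) (\<lambda>w. w u)"
      unfolding stone_cech_def Let_def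
      by (rule continuous_map_from_subtopology [OF continuous_map_product_projection [OF u]])
    then show ?thesis
      by (simp add: continuous_map_in_subtopology)
  qed
  then have "continuous_map ?B euclideanreal (\<lambda>w. w u * (2 * M) - M)"
    by (intro continuous_intros) auto
  then have cg: "continuous_map ?B euclideanreal g"
    by (rule continuous_map_eq) (auto simp: g_def)
  have gf: "g (sc_map X x) = f x" if "x \<in> topspace X" for x
    using that u M(1) sc_map_in_stone_cech[OF that] by (simp add: g_def sc_map_def) (simp add: u_def)
  show ?thesis
  proof (rule ex1I [of _ g])
    show "g \<in> extensional (topspace ?B) \<and> continuous_map ?B euclideanreal g \<and>
        (\<forall>x\<in>topspace X. g (sc_map X x) = f x)"
      using cg gf by (simp add: g_def)
  next
    fix g' assume g': "g' \<in> extensional (topspace ?B) \<and> continuous_map ?B euclideanreal g' \<and>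
        (\<forall>x\<in>topspace X. g' (sc_map X x) = f x)"
    have "g' w = g w" if "w \<in> topspace ?B" for w
    proof (rule forall_in_closure_of_eq [of w ?B "sc_map X ` topspace X" euclideanreal])
      show "w \<in> ?B closure_of sc_map X ` topspace X"
        using that by (simp add: stone_cech_dense)
    qed (use g' cg gf in auto)
    then show "g' = g"
      using g' by (auto simp: g_def fun_eq_iff extensional_def)
  qed
qed


section \<open>Realcompact spaces and the realcompactification\<close>

text \<open>A space is realcompact if it is homeomorphic to a closed subspace of a power of the
  real line. HOL cannot quantify over the type of the index set, but real-valued functions
  on the space are enough as indices: see \<open>realcompact_spaceI\<close>.\<close>

definition realcompact_space :: "'b topology \<Rightarrow> bool" where
  "realcompact_space Z \<longleftrightarrow>
     (\<exists>(I :: ('b \<Rightarrow> real) set) F. closedin (real_power I) F \<and>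
        Z homeomorphic_space subtopology (real_power I) F)"

lemma realcompact_spaceI:
  fixes Z :: "'b topology" and I :: "'i set"
  assumes cl: "closedin (real_power I) F"
    and hom: "Z homeomorphic_space subtopology (real_power I) F"
  shows "realcompact_space Z"
proof -
  obtain h k where hk: "homeomorphic_maps Z (subtopology (real_power I) F) h k"
    using hom by (auto simp: homeomorphic_space_def)
  have Fsub: "F \<subseteq> topspace (real_power I)"
    using cl by (rule closedin_subset)
  have ch: "continuous_map Z (real_power I) h" and hF: "\<And>z. z \<in> topspace Z \<Longrightarrow> h z \<in> F"
    and ck: "continuous_map (subtopology (real_power I) F) Z k"
    and kh: "\<And>z. z \<in> topspace Z \<Longrightarrow> k (h z) = z"
    and hk': "\<And>w. w \<in> F \<Longrightarrow> h (k w) = w"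
    using hk Fsub by (auto simp: homeomorphic_maps_def continuous_map_in_subtopology)
  have kF: "\<And>w. w \<in> F \<Longrightarrow> k w \<in> topspace Z"
    using ck Fsub by (auto simp: continuous_map_def)
  define \<gamma> where "\<gamma> = (\<lambda>i. restrict (\<lambda>z. h z i) (topspace Z))"
  define J where "J = \<gamma> ` I"
  define \<phi> :: "(('b \<Rightarrow> real) \<Rightarrow> real) \<Rightarrow> 'i \<Rightarrow> real" where "\<phi> = (\<lambda>w. \<lambda>i\<in>I. w (\<gamma> i))"
  define h' where "h' = (\<lambda>z. \<lambda>j\<in>J. j z)"
  define F' where "F' = {w \<in> topspace (real_power J). \<phi> w \<in> F}"
  have c\<phi>: "continuous_map (real_power J) (real_power I) \<phi>"
    unfolding \<phi>_def continuous_map_componentwise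
    by (auto simp: J_def intro!: continuous_map_product_projection)
  have cl': "closedin (real_power J) F'"
    unfolding F'_def by (rule closedin_continuous_map_preimage [OF c\<phi> cl])
  have \<phi>h': "\<phi> (h' z) = h z" if "z \<in> topspace Z" for z
  proof -
    have "h z \<in> extensional I"
      using hF[OF that] Fsub by (auto simp: PiE_def)
    then show ?thesis
      using that by (auto simp: \<phi>_def h'_def J_def \<gamma>_def fun_eq_iff extensional_def)
  qed
  have ch': "continuous_map Z (real_power J) h'"
    unfolding h'_def continuous_map_componentwise
  proof (intro conjI ballI)
    fix j assume "j \<in> J"
    then obtain i where i: "i \<in> I" "j = \<gamma> i" by (auto simp: J_def)
    have "continuous_map Z euclideanreal (\<lambda>z. h z i)"
      using ch i by (auto simp: continuous_map_componentwise)
    then have "continuous_map Z euclideanreal j"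
      by (rule continuous_map_eq) (auto simp: i \<gamma>_def)
    then show "continuous_map Z euclideanreal (\<lambda>z. (\<lambda>j\<in>J. j z) j)"
      using \<open>j \<in> J\<close> by simp
  qed auto
  have inv: "h' (k (\<phi> w)) = w" if "w \<in> F'" for w
  proof -
    have w: "w \<in> extensional J" "\<phi> w \<in> F"
      using that by (auto simp: F'_def PiE_def)
    have "w (\<gamma> i) = \<gamma> i (k (\<phi> w))" if "i \<in> I" for i
    proof -
      have "w (\<gamma> i) = \<phi> w i" using that by (simp add: \<phi>_def)
      also have "\<dots> = h (k (\<phi> w)) i" using w hk' by simp
      also have "\<dots> = \<gamma> i (k (\<phi> w))" using kF w by (simp add: \<gamma>_def)
      finally show ?thesis .
    qed
    then show ?thesis
      using w by (auto simp: h'_def J_def fun_eq_iff extensional_def)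
  qed
  have "homeomorphic_maps Z (subtopology (real_power J) F') h' (k \<circ> \<phi>)"
    unfolding homeomorphic_maps_def
  proof (intro conjI ballI)
    have "h' z \<in> F'" if "z \<in> topspace Z" for z
      using that \<phi>h' hF by (simp add: F'_def h'_def)
    then show "continuous_map Z (subtopology (real_power J) F') h'"
      using ch' by (auto simp: continuous_map_in_subtopology)
    have "continuous_map (subtopology (real_power J) F') (subtopology (real_power I) F) \<phi>"
      using c\<phi> by (auto simp: continuous_map_in_subtopology F'_def continuous_map_from_subtopology)
    then show "continuous_map (subtopology (real_power J) F') Z (k \<circ> \<phi>)"
      using ck by (rule continuous_map_compose)
  qed (use \<phi>h' kh inv in auto)
  then show ?thesis
    unfolding realcompact_space_def homeomorphic_space_def using cl' by blast
qed

definition realcompactification :: "'a topology \<Rightarrow> (('a \<Rightarrow> real) \<Rightarrow> real) set" where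
  "realcompactification X =
     \<Inter>{T. sc_map X ` topspace X \<subseteq> T \<and> T \<subseteq> topspace (stone_cech X) \<and>
          realcompact_space (subtopology (stone_cech X) T)}"

text \<open>The intersection is itself realcompact, hence is the smallest realcompact subspace of
  \<open>\<beta>X\<close> that contains \<open>X\<close>.\<close>

lemma realcompact_space_Inter:
  assumes B: "Hausdorff_space B" and ne: "\<T> \<noteq> {}"
    and rc: "\<And>T. T \<in> \<T> \<Longrightarrow> T \<subseteq> topspace B \<and> realcompact_space (subtopology B T)"
  shows "realcompact_space (subtopology B (\<Inter>\<T>))"
proof -
  have "\<forall>T\<in>\<T>. \<exists>I :: ('a \<Rightarrow> real) set. \<exists>F h k. closedin (real_power I) F \<and>
      homeomorphic_maps (subtopology B T) (subtopology (real_power I) F) h k"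
    using rc by (fastforce simp: realcompact_space_def homeomorphic_space_def)
  then obtain I :: "'a set \<Rightarrow> ('a \<Rightarrow> real) set" and F h k where
      cl: "\<And>T. T \<in> \<T> \<Longrightarrow> closedin (real_power (I T)) (F T)"
      and hk: "\<And>T. T \<in> \<T> \<Longrightarrow>
        homeomorphic_maps (subtopology B T) (subtopology (real_power (I T)) (F T)) (h T) (k T)"
    by metis
  have Fsub: "F T \<subseteq> topspace (real_power (I T))" if "T \<in> \<T>" for T
    using cl[OF that] by (rule closedin_subset)
  have TB: "T \<subseteq> topspace B" if "T \<in> \<T>" for T
    using rc that by blast
  have ch: "continuous_map (subtopology B T) (real_power (I T)) (h T)"
    and hF: "\<And>b. b \<in> T \<Longrightarrow> h T b \<in> F T"
    and ck: "continuous_map (subtopology (real_power (I T)) (F T)) (subtopology B T) (k T)"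
    and kh: "\<And>b. b \<in> T \<Longrightarrow> k T (h T b) = b"
    and hk': "\<And>w. w \<in> F T \<Longrightarrow> h T (k T w) = w"
    if "T \<in> \<T>" for T
    using hk[OF that] Fsub[OF that] TB[OF that]
    by (auto simp: homeomorphic_maps_def continuous_map_in_subtopology)
  have kT: "k T w \<in> T" if "T \<in> \<T>" "w \<in> F T" for T w
    using ck[OF that(1)] Fsub[OF that(1)] that(2) by (auto simp: continuous_map_def)
  define S where "S = \<Inter>\<T>"
  have ST: "S \<subseteq> T" if "T \<in> \<T>" for T
    using that by (auto simp: S_def)
  have SB: "S \<subseteq> topspace B"
    using ne ST TB by blast
  define J where "J = Sigma \<T> I"
  define p :: "'a set \<Rightarrow> ('a set \<times> ('a \<Rightarrow> real) \<Rightarrow> real) \<Rightarrow> ('a \<Rightarrow> real) \<Rightarrow> real"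
    where "p = (\<lambda>T w. \<lambda>i\<in>I T. w (T, i))"
  have cp: "continuous_map (real_power J) (real_power (I T)) (p T)" if "T \<in> \<T>" for T
    unfolding p_def continuous_map_componentwise
    using that by (auto simp: J_def intro!: continuous_map_product_projection)
  define F1 where "F1 = (\<Inter>T\<in>\<T>. {w \<in> topspace (real_power J). p T w \<in> F T})"
  have clF1: "closedin (real_power J) F1"
    unfolding F1_def
  proof (intro closedin_Inter)
    fix C assume "C \<in> (\<lambda>T. {w \<in> topspace (real_power J). p T w \<in> F T}) ` \<T>"
    then show "closedin (real_power J) C"
      using closedin_continuous_map_preimage [OF cp cl] by blast
  qed (use ne in auto)
  have F1sub: "F1 \<subseteq> topspace (real_power J)"
    using clF1 by (rule closedin_subset)
  define q where "q = (\<lambda>T w. k T (p T w))"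
  have cq: "continuous_map (subtopology (real_power J) F1) B (q T)" if "T \<in> \<T>" for T
  proof -
    have "continuous_map (subtopology (real_power J) F1) (subtopology (real_power (I T)) (F T)) (p T)"
      using cp[OF that] that
      by (auto simp: continuous_map_in_subtopology F1_def continuous_map_from_subtopology)
    moreover have "continuous_map (subtopology (real_power (I T)) (F T)) B (k T)"
      using ck[OF that] by (simp add: continuous_map_in_subtopology)
    ultimately show ?thesis
      unfolding q_def using continuous_map_compose by (fastforce simp: o_def)
  qed
  obtain T0 where T0: "T0 \<in> \<T>" using ne by blast
  define F2 where "F2 = (\<Inter>T\<in>\<T>. {w \<in> F1. q T w = q T0 w})"
  have "closedin (subtopology (real_power J) F1) F2"
    unfolding F2_def
  proof (intro closedin_Inter)
    fix C assume "C \<in> (\<lambda>T. {w \<in> F1. q T w = q T0 w}) ` \<T>"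
    then obtain T where T: "T \<in> \<T>" "C = {w \<in> F1. q T w = q T0 w}" by blast
    have "C = {w \<in> topspace (subtopology (real_power J) F1). q T w = q T0 w}"
      using F1sub T(2) by auto
    then show "closedin (subtopology (real_power J) F1) C"
      using closedin_continuous_maps_eq [OF B cq[OF T(1)] cq[OF T0]] by simp
  qed (use ne in auto)
  then have clF2: "closedin (real_power J) F2"
    using clF1 closedin_trans_full by blast
  have F2F1: "F2 \<subseteq> F1" using T0 by (auto simp: F2_def)
  define H where "H = (\<lambda>b. \<lambda>(T, i)\<in>J. h T b i)"
  have pH: "p T (H b) = h T b" if "T \<in> \<T>" "b \<in> S" for T b
  proof -
    have "h T b \<in> extensional (I T)"
      using hF[OF that(1), of b] ST that Fsub[OF that(1)] by (auto simp: PiE_def)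
    then show ?thesis
      using that by (auto simp: p_def H_def J_def fun_eq_iff extensional_def)
  qed
  have qH: "q T (H b) = b" if "T \<in> \<T>" "b \<in> S" for T b
    using pH[OF that] kh[OF that(1)] ST that by (auto simp: q_def)
  have HF2: "H b \<in> F2" if "b \<in> S" for b
  proof -
    have "H b \<in> F1"
      using that pH hF ST ne by (fastforce simp: F1_def H_def)
    then show ?thesis
      using that qH T0 by (auto simp: F2_def)
  qed
  have cH: "continuous_map (subtopology B S) (real_power J) H"
    unfolding H_def continuous_map_componentwise
  proof (intro conjI ballI)
    fix j assume "j \<in> J"
    then obtain T i where j: "j = (T, i)" "T \<in> \<T>" "i \<in> I T" by (auto simp: J_def)
    have "continuous_map (subtopology B T) euclideanreal (\<lambda>b. h T b i)"
      using ch j by (auto simp: continuous_map_componentwise)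
    then have "continuous_map (subtopology B S) euclideanreal (\<lambda>b. h T b i)"
      using ST[OF j(2)] by (rule continuous_map_from_subtopology_mono)
    then show "continuous_map (subtopology B S) euclideanreal (\<lambda>b. (\<lambda>(T, i)\<in>J. h T b i) j)"
      using \<open>j \<in> J\<close> by (simp add: j)
  qed auto
  have qS: "q T0 w \<in> S" if "w \<in> F2" for w
  proof -
    have "q T0 w \<in> T" if "T \<in> \<T>" for T
    proof -
      have "q T w \<in> T"
        using \<open>w \<in> F2\<close> F2F1 that kT by (auto simp: q_def F1_def)
      then show ?thesis
        using \<open>w \<in> F2\<close> that by (auto simp: F2_def)
    qed
    then show ?thesis by (auto simp: S_def)
  qed
  have Hq: "H (q T0 w) = w" if "w \<in> F2" for w
  proof -
    have ext: "w \<in> extensional J"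
      using that F2F1 F1sub by (auto simp: PiE_def)
    have "h T (q T0 w) i = w (T, i)" if "T \<in> \<T>" "i \<in> I T" for T i
    proof -
      have "q T0 w = q T w" "p T w \<in> F T"
        using that \<open>w \<in> F2\<close> F2F1 by (auto simp: F2_def F1_def)
      then have "h T (q T0 w) = p T w"
        using hk'[OF that(1)] by (simp add: q_def)
      then show ?thesis using that by (simp add: p_def)
    qed
    then show ?thesis
      using ext by (auto simp: H_def J_def fun_eq_iff extensional_def)
  qed
  have "homeomorphic_maps (subtopology B S) (subtopology (real_power J) F2) H (q T0)"
    unfolding homeomorphic_maps_def
  proof (intro conjI ballI)
    show "continuous_map (subtopology B S) (subtopology (real_power J) F2) H"
      using cH HF2 by (auto simp: continuous_map_in_subtopology)
    show "continuous_map (subtopology (real_power J) F2) (subtopology B S) (q T0)"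
      using continuous_map_from_subtopology_mono [OF cq[OF T0] F2F1] qS
      by (auto simp: continuous_map_in_subtopology)
  qed (use qH T0 Hq in auto)
  then show ?thesis
    using realcompact_spaceI [OF clF2] unfolding homeomorphic_space_def S_def by blast
qed

lemma realcompact_stone_cech: "realcompact_space (stone_cech X)"
proof -
  let ?P = "real_power (unit_functions X)"
  let ?F = "topspace (stone_cech X)"
  have "product_topology (\<lambda>_. top_of_set {0..1}) (unit_functions X) =
      subtopology ?P (\<Pi>\<^sub>E f\<in>unit_functions X. {0..1})"
    by (rule subtopology_product_topology [symmetric])
  then have "stone_cech X = subtopology ?P ((\<Pi>\<^sub>E f\<in>unit_functions X. {0..1}) \<inter>
      product_topology (\<lambda>_. top_of_set {0..1}) (unit_functions X) closure_of (sc_map X ` topspace X))"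
    by (simp add: stone_cech_def Let_def subtopology_subtopology)
  then obtain W where W: "stone_cech X = subtopology ?P W"
    by blast
  then have eq: "stone_cech X = subtopology ?P ?F"
    by (metis subtopology_restrict topspace_subtopology)
  moreover have "?F \<subseteq> topspace ?P"
    using W by simp
  ultimately have "compactin ?P ?F"
    using compact_space_stone_cech [of X] by (metis compact_space_subtopology compact_space_def compactin_subtopology)
  then have "closedin ?P ?F"
    by (intro compactin_imp_closedin) (simp_all add: Hausdorff_space_product_topology)
  then show ?thesis
    by (rule realcompact_spaceI) (use eq homeomorphic_space_refl in metis)
qed

lemma realcompact_realcompactification:
  "realcompact_space (subtopology (stone_cech X) (realcompactification X))"
  unfolding realcompactification_def
proof (rule realcompact_space_Inter)
  have "topspace (stone_cech X) \<in> {T. sc_map X ` topspace X \<subseteq> T \<and> T \<subseteq> topspace (stone_cech X) \<and>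
          realcompact_space (subtopology (stone_cech X) T)}"
    using sc_map_in_stone_cech realcompact_stone_cech by auto
  then show "{T. sc_map X ` topspace X \<subseteq> T \<and> T \<subseteq> topspace (stone_cech X) \<and>
          realcompact_space (subtopology (stone_cech X) T)} \<noteq> {}"
    by blast
qed (auto simp: Hausdorff_space_stone_cech)


section \<open>Kappa-spaces and the kappa-completion\<close>

text \<open>Again HOL cannot quantify over the type of the points of the locally compact space
  \<open>Y\<close>. The type below is large enough for this to be no restriction: see
  \<open>kappa_spaceI\<close>, where \<open>Y\<close> has an arbitrary type.\<close>

definition kappa_space :: "'b topology \<Rightarrow> bool" where
  "kappa_space Z \<longleftrightarrow> tychonoff_space Z \<and>
     (\<exists>(Y :: (('b \<Rightarrow> real) set \<times> ('b \<Rightarrow> real)) topology) F.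
        locally_compact_space Y \<and> Hausdorff_space Y \<and> closedin (Cp Y) F \<and>
        Z homeomorphic_space subtopology (Cp Y) F)"

lemma continuous_map_sum_topology:
  assumes "\<And>i. i \<in> I \<Longrightarrow> continuous_map (X i) Y (\<lambda>x. f (i, x))"
  shows "continuous_map (sum_topology X I) Y f"
  unfolding continuous_map_def openin_sum_topology
proof (intro conjI allI impI ballI)
  show "f \<in> topspace (sum_topology X I) \<rightarrow> topspace Y"
    using assms by (fastforce simp: continuous_map_def)
next
  fix U i assume "openin Y U" "i \<in> I"
  then show "openin (X i) {x. (i, x) \<in> {x \<in> topspace (sum_topology X I). f x \<in> U}}"
    using openin_continuous_map_preimage [OF assms] by simp
qed auto

lemma Hausdorff_space_sum_topology:
  assumes "\<And>i. i \<in> I \<Longrightarrow> Hausdorff_space (X i)"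
  shows "Hausdorff_space (sum_topology X I)"
  unfolding Hausdorff_space_def
proof (intro allI impI)
  fix a b
  assume ab: "a \<in> topspace (sum_topology X I) \<and> b \<in> topspace (sum_topology X I) \<and> a \<noteq> b"
  obtain i x j y where eq: "a = (i, x)" "b = (j, y)" by (metis surj_pair)
  then have *: "i \<in> I" "x \<in> topspace (X i)" "j \<in> I" "y \<in> topspace (X j)"
    and ne: "(i, x) \<noteq> (j, y)"
    using ab by auto
  have "\<exists>U V. openin (sum_topology X I) U \<and> openin (sum_topology X I) V \<and>
      (i, x) \<in> U \<and> (j, y) \<in> V \<and> disjnt U V"
  proof (cases "i = j")
    case True
    then obtain U V where UV: "openin (X i) U" "openin (X i) V" "x \<in> U" "y \<in> V" "disjnt U V"
      using assms[OF *(1)] * ne unfolding Hausdorff_space_def by blast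
    show ?thesis
    proof (intro exI conjI)
      show "openin (sum_topology X I) (Pair i ` U)" "openin (sum_topology X I) (Pair i ` V)"
        using open_map_component_injection [OF *(1)] UV by (auto simp: open_map_def)
    qed (use True UV in \<open>auto simp: disjnt_iff\<close>)
  next
    case False
    show ?thesis
    proof (intro exI conjI)
      show "openin (sum_topology X I) (Pair i ` topspace (X i))"
        using open_map_component_injection [OF *(1)] by (auto simp: open_map_def)
      show "openin (sum_topology X I) (Pair j ` topspace (X j))"
        using open_map_component_injection [OF *(3)] by (auto simp: open_map_def)
    qed (use False * in \<open>auto simp: disjnt_iff\<close>)
  qed
  then show "\<exists>U V. openin (sum_topology X I) U \<and> openin (sum_topology X I) V \<and>
      a \<in> U \<and> b \<in> V \<and> disjnt U V"
    by (simp add: eq)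
qed

lemma locally_compact_space_sum_topology:
  assumes "\<And>i. i \<in> I \<Longrightarrow> compact_space (X i)"
  shows "locally_compact_space (sum_topology X I)"
  unfolding locally_compact_space_def
proof clarify
  fix i x assume "(i, x) \<in> topspace (sum_topology X I)"
  then have i: "i \<in> I" "x \<in> topspace (X i)" by auto
  show "\<exists>U K. openin (sum_topology X I) U \<and> compactin (sum_topology X I) K \<and> (i, x) \<in> U \<and> U \<subseteq> K"
  proof (intro exI conjI)
    show "openin (sum_topology X I) (Pair i ` topspace (X i))"
      using open_map_component_injection [OF i(1)] by (auto simp: open_map_def)
    show "compactin (sum_topology X I) (Pair i ` topspace (X i))"
      using assms[OF i(1)] continuous_map_component_injection [OF i(1)]
      unfolding compact_space_def by (rule image_compactin)
  qed (use i in auto)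
qed

lemma tychonoff_space_real_power_subspace:
  assumes "Z homeomorphic_space subtopology (real_power I) F"
  shows "tychonoff_space Z"
proof -
  have "completely_regular_space euclideanreal"
    by (simp add: metrizable_imp_completely_regular_space metrizable_space_euclidean)
  then have "completely_regular_space (subtopology (real_power I) F)"
    by (simp add: completely_regular_space_subtopology completely_regular_space_product_topology)
  moreover have "Hausdorff_space (subtopology (real_power I) F)"
    by (simp add: Hausdorff_space_subtopology Hausdorff_space_product_topology)
  ultimately show ?thesis
    unfolding tychonoff_space_def
    using assms homeomorphic_completely_regular_space homeomorphic_Hausdorff_space by blast
qed

lemma kappa_spaceI:
  fixes Z :: "'b topology" and Y :: "'c topology"
  assumes lc: "locally_compact_space Y" and "Hausdorff_space Y"
    and cl: "closedin (Cp Y) F" and hom: "Z homeomorphic_space subtopology (Cp Y) F"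
  shows "kappa_space Z"
proof -
  obtain h k where hk: "homeomorphic_maps Z (subtopology (Cp Y) F) h k"
    using hom by (auto simp: homeomorphic_space_def)
  have Fsub: "F \<subseteq> topspace (Cp Y)"
    using cl by (rule closedin_subset)
  have ch: "continuous_map Z (Cp Y) h" and hF: "\<And>z. z \<in> topspace Z \<Longrightarrow> h z \<in> F"
    and ck: "continuous_map (subtopology (Cp Y) F) Z k"
    and kh: "\<And>z. z \<in> topspace Z \<Longrightarrow> k (h z) = z"
    and hk': "\<And>w. w \<in> F \<Longrightarrow> h (k w) = w"
    using hk Fsub by (auto simp: homeomorphic_maps_def continuous_map_in_subtopology)
  have kF: "\<And>w. w \<in> F \<Longrightarrow> k w \<in> topspace Z"
    using ck Fsub by (auto simp: continuous_map_def)
  have Fc: "continuous_map Y euclideanreal w" "w \<in> extensional (topspace Y)" if "w \<in> F" for w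
    using that Fsub by (auto simp: topspace_Cp)
  let ?R = "real_power (topspace Z)"
  define \<gamma> where "\<gamma> = (\<lambda>y. \<lambda>z\<in>topspace Z. h z y)"
  have c\<gamma>: "continuous_map Y ?R \<gamma>"
    unfolding \<gamma>_def continuous_map_componentwise using hF Fc by auto
  have \<gamma>c: "continuous_map Z euclideanreal (\<gamma> y)" if "y \<in> topspace Y" for y
  proof -
    have "continuous_map Z euclideanreal (\<lambda>z. h z y)"
      using ch that by (auto simp: Cp_def continuous_map_in_subtopology continuous_map_componentwise)
    then show ?thesis
      by (rule continuous_map_eq) (auto simp: \<gamma>_def)
  qed
  text \<open>Replace \<open>Y\<close> by the topological sum of the images of its compact subsets.\<close>
  define \<L> where "\<L> = (\<lambda>K. \<gamma> ` K) ` {K. compactin Y K}"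
  define Y' where "Y' = sum_topology (subtopology ?R) \<L>"
  have Lsub: "L \<subseteq> topspace ?R" "compactin ?R L" if "L \<in> \<L>" for L
  proof -
    show "compactin ?R L"
      using that c\<gamma> by (auto simp: \<L>_def intro: image_compactin)
    then show "L \<subseteq> topspace ?R" by (rule compactin_subset_topspace)
  qed
  have Y'top: "topspace Y' = Sigma \<L> (\<lambda>L. L)"
    using Lsub by (fastforce simp: Y'_def)
  have lc': "locally_compact_space Y'"
    unfolding Y'_def by (rule locally_compact_space_sum_topology) (use Lsub in \<open>auto simp: compact_space_subtopology\<close>)
  have H': "Hausdorff_space Y'"
    unfolding Y'_def
    by (rule Hausdorff_space_sum_topology) (simp add: Hausdorff_space_subtopology Hausdorff_space_product_topology)
  have Lpt: "\<exists>y\<in>topspace Y. u = \<gamma> y" if "L \<in> \<L>" "u \<in> L" for L u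
    using that compactin_subset_topspace by (fastforce simp: \<L>_def)
  have sing: "({\<gamma> y}, \<gamma> y) \<in> topspace Y'" if "y \<in> topspace Y" for y
  proof -
    have "{\<gamma> y} = \<gamma> ` {y}" "compactin Y {y}" using that by auto
    then have "{\<gamma> y} \<in> \<L>" unfolding \<L>_def by blast
    then show ?thesis by (simp add: Y'top)
  qed
  define E where "E = {w \<in> topspace (Cp Y'). \<forall>(L, u)\<in>topspace Y'. w (L, u) = w ({u}, u)}"
  define \<phi> :: "(('b \<Rightarrow> real) set \<times> ('b \<Rightarrow> real) \<Rightarrow> real) \<Rightarrow> 'c \<Rightarrow> real"
    where "\<phi> = (\<lambda>w. \<lambda>y\<in>topspace Y. w ({\<gamma> y}, \<gamma> y))"
  have proj: "continuous_map (Cp Y') euclideanreal (\<lambda>w. w t)" if "t \<in> topspace Y'" for t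
    unfolding Cp_def
    by (rule continuous_map_from_subtopology [OF continuous_map_product_projection [OF that]])
  have clE: "closedin (Cp Y') E"
  proof -
    have "closedin (Cp Y') {w \<in> topspace (Cp Y'). w (L, u) = w ({u}, u)}" if "(L, u) \<in> topspace Y'" for L u
    proof (rule closedin_continuous_maps_eq [of euclideanreal])
      show "continuous_map (Cp Y') euclideanreal (\<lambda>w. w (L, u))"
        using that by (rule proj)
      have "({u}, u) \<in> topspace Y'"
        using that Lpt sing by (fastforce simp: Y'top)
      then show "continuous_map (Cp Y') euclideanreal (\<lambda>w. w ({u}, u))"
        by (rule proj)
    qed auto
    then have "closedin (Cp Y') (topspace (Cp Y') \<inter>
        \<Inter>((\<lambda>(L, u). {w \<in> topspace (Cp Y'). w (L, u) = w ({u}, u)}) ` topspace Y'))"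
      by (cases "topspace Y' = {}") (auto intro!: closedin_Int closedin_Inter)
    also have "(topspace (Cp Y') \<inter>
        \<Inter>((\<lambda>(L, u). {w \<in> topspace (Cp Y'). w (L, u) = w ({u}, u)}) ` topspace Y')) = E"
      by (fastforce simp: E_def)
    finally show ?thesis .
  qed
  have \<phi>c: "continuous_map Y euclideanreal (\<phi> w)" if "w \<in> E" for w
  proof (rule continuous_map_from_k_space [OF locally_compact_imp_k_space [OF lc]])
    fix K assume K: "compactin Y K"
    then have L: "\<gamma> ` K \<in> \<L>" and KY: "K \<subseteq> topspace Y"
      by (auto simp: \<L>_def compactin_subset_topspace)
    have "continuous_map (subtopology Y K) (subtopology ?R (\<gamma> ` K)) \<gamma>"
      using c\<gamma> by (auto simp: continuous_map_in_subtopology continuous_map_from_subtopology)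
    moreover have "continuous_map (subtopology ?R (\<gamma> ` K)) Y' (Pair (\<gamma> ` K))"
      unfolding Y'_def using L by (rule continuous_map_component_injection)
    moreover have "continuous_map Y' euclideanreal w"
      using that by (simp add: E_def topspace_Cp)
    ultimately have "continuous_map (subtopology Y K) euclideanreal (w \<circ> (Pair (\<gamma> ` K) \<circ> \<gamma>))"
      by (intro continuous_map_compose)
    then show "continuous_map (subtopology Y K) euclideanreal (\<phi> w)"
    proof (rule continuous_map_eq)
      fix y assume y: "y \<in> topspace (subtopology Y K)"
      then have "(\<gamma> ` K, \<gamma> y) \<in> topspace Y'"
        using L by (simp add: Y'top)
      then show "(w \<circ> (Pair (\<gamma> ` K) \<circ> \<gamma>)) y = \<phi> w y"
        using y that by (auto simp: E_def \<phi>_def)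
    qed
  qed
  have c\<phi>: "continuous_map (subtopology (Cp Y') E) (Cp Y) \<phi>"
    unfolding Cp_def [of Y] continuous_map_in_subtopology
  proof
    show "continuous_map (subtopology (Cp Y') E) (real_power (topspace Y)) \<phi>"
      unfolding \<phi>_def continuous_map_componentwise
      using proj sing by (auto intro: continuous_map_from_subtopology)
    show "\<phi> \<in> topspace (subtopology (Cp Y') E) \<rightarrow> {f. continuous_map Y euclideanreal f}"
      using \<phi>c by auto
  qed
  have Etop: "topspace (subtopology (Cp Y') E) = E"
    by (auto simp: E_def)
  define F' where "F' = {w \<in> E. \<phi> w \<in> F}"
  have "closedin (subtopology (Cp Y') E) F'"
    using closedin_continuous_map_preimage [OF c\<phi> cl] unfolding F'_def Etop .
  then have cl': "closedin (Cp Y') F'"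
    using clE closedin_trans_full by blast
  define h' where "h' = (\<lambda>z. \<lambda>(L, u)\<in>topspace Y'. u z)"
  have h'E: "h' z \<in> E" if "z \<in> topspace Z" for z
  proof -
    have "continuous_map Y' euclideanreal (\<lambda>t. snd t z)"
      unfolding Y'_def
      by (rule continuous_map_sum_topology)
        (auto intro: continuous_map_from_subtopology continuous_map_product_projection that)
    then have "continuous_map Y' euclideanreal (h' z)"
      by (rule continuous_map_eq) (auto simp: h'_def)
    moreover have "({u}, u) \<in> topspace Y'" if "(L, u) \<in> topspace Y'" for L u
      using that Lpt sing by (fastforce simp: Y'top)
    ultimately show ?thesis
      by (auto simp: E_def topspace_Cp h'_def)
  qed
  have \<phi>h': "\<phi> (h' z) = h z" if "z \<in> topspace Z" for z
    using Fc(2)[OF hF[OF that]] that sing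
    by (auto simp: \<phi>_def h'_def \<gamma>_def fun_eq_iff extensional_def)
  have ch': "continuous_map Z (Cp Y') h'"
    unfolding Cp_def continuous_map_in_subtopology
  proof
    show "continuous_map Z (real_power (topspace Y')) h'"
      unfolding h'_def continuous_map_componentwise
    proof (intro conjI ballI)
      fix t assume t: "t \<in> topspace Y'"
      then obtain y where y: "y \<in> topspace Y" "snd t = \<gamma> y"
        using Lpt by (fastforce simp: Y'top)
      show "continuous_map Z euclideanreal (\<lambda>z. (\<lambda>(L, u)\<in>topspace Y'. u z) t)"
        using \<gamma>c[OF y(1)] t y(2) by (auto simp: case_prod_unfold)
    qed auto
    show "h' \<in> topspace Z \<rightarrow> {f. continuous_map Y' euclideanreal f}"
      using h'E by (auto simp: E_def topspace_Cp)
  qed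
  have inv: "h' (k (\<phi> w)) = w" if "w \<in> F'" for w
  proof -
    have w: "w \<in> E" "\<phi> w \<in> F" "w \<in> extensional (topspace Y')"
      using that by (auto simp: F'_def E_def topspace_Cp)
    have "w (L, u) = u (k (\<phi> w))" if Lu: "(L, u) \<in> topspace Y'" for L u
    proof -
      obtain y where y: "y \<in> topspace Y" "u = \<gamma> y"
        using Lu Lpt by (fastforce simp: Y'top)
      have "w (L, u) = w ({u}, u)" using w(1) Lu by (auto simp: E_def)
      also have "\<dots> = \<phi> w y" using y by (simp add: \<phi>_def)
      also have "\<dots> = h (k (\<phi> w)) y" using w hk' by simp
      also have "\<dots> = u (k (\<phi> w))" using y kF w by (simp add: \<gamma>_def)
      finally show ?thesis .
    qed
    then show ?thesis
      using w(3) by (auto simp: h'_def fun_eq_iff extensional_def)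
  qed
  have "homeomorphic_maps Z (subtopology (Cp Y') F') h' (k \<circ> \<phi>)"
    unfolding homeomorphic_maps_def
  proof (intro conjI ballI)
    show "continuous_map Z (subtopology (Cp Y') F') h'"
      using ch' \<phi>h' hF h'E by (auto simp: continuous_map_in_subtopology F'_def)
    have "continuous_map (subtopology (Cp Y') F') (subtopology (Cp Y) F) \<phi>"
      using continuous_map_from_subtopology_mono [OF c\<phi>, of F']
      by (auto simp: continuous_map_in_subtopology F'_def)
    then show "continuous_map (subtopology (Cp Y') F') Z (k \<circ> \<phi>)"
      using ck by (rule continuous_map_compose)
  qed (use \<phi>h' kh inv in auto)
  then have "Z homeomorphic_space subtopology (Cp Y') F'"
    unfolding homeomorphic_space_def by blast
  moreover have "tychonoff_space Z"
    using hom unfolding Cp_def subtopology_subtopology by (rule tychonoff_space_real_power_subspace)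
  ultimately show ?thesis
    unfolding kappa_space_def using lc' H' cl' by blast
qed

lemma realcompact_imp_kappa_space:
  fixes Z :: "'b topology"
  assumes "realcompact_space Z"
  shows "kappa_space Z"
proof -
  obtain I :: "('b \<Rightarrow> real) set" and F where IF: "closedin (real_power I) F" "Z homeomorphic_space subtopology (real_power I) F"
    using assms unfolding realcompact_space_def by blast
  have "{f. continuous_map (discrete_topology I) euclideanreal f} = UNIV"
    by (simp add: continuous_map_def)
  then have Cp_eq: "Cp (discrete_topology I) = real_power I"
    unfolding Cp_def topspace_discrete_topology by (simp only: subtopology_UNIV)
  show ?thesis
  proof (rule kappa_spaceI)
    show "locally_compact_space (discrete_topology I)"
      by (rule locally_compact_space_discrete_topology)
    show "Hausdorff_space (discrete_topology I)"
      by (rule Hausdorff_space_discrete_topology)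
    show "closedin (Cp (discrete_topology I)) F"
      unfolding Cp_eq by (rule IF)
    show "Z homeomorphic_space subtopology (Cp (discrete_topology I)) F"
      unfolding Cp_eq by (rule IF)
  qed
qed

definition kappa_completion :: "'a topology \<Rightarrow> (('a \<Rightarrow> real) \<Rightarrow> real) set" where
  "kappa_completion X =
     \<Inter>{T. sc_map X ` topspace X \<subseteq> T \<and> T \<subseteq> topspace (stone_cech X) \<and>
          kappa_space (subtopology (stone_cech X) T)}"

lemma kappa_stone_cech: "kappa_space (stone_cech X)"
  by (simp add: realcompact_imp_kappa_space realcompact_stone_cech)

end

theory Submission
  imports Defs
begin

text \<open>
  Points \<open>x\<close> of \<open>X\<close> are identified with their images in \<open>\<beta>X\<close>; then \<open>\<delta>\<^sub>x\<close> is evaluation at \<open>x\<close>.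

  Sufficiency of the two conditions. Let \<open>T\<close> be a subspace with \<open>X \<subseteq> T \<subseteq> \<beta>X\<close> and let \<open>h\<close> be a
  homeomorphism of \<open>T\<close> onto a closed subspace of \<open>C\<^sub>p(Y)\<close>; for discrete \<open>Y\<close> this says that \<open>T\<close> is
  realcompact, for locally compact \<open>Y\<close> that it is a \<open>\<kappa>\<close>-space. Every \<open>y \<in> Y\<close> yields the continuous
  function \<open>h\<^sub>y(x) = h(x)(y)\<close> on \<open>X\<close>, which is a quotient of the bounded functions
  \<open>h\<^sub>y / (1 + \<bar>h\<^sub>y\<bar>)\<close> and \<open>1 / (1 + \<bar>h\<^sub>y\<bar>)\<close>. If \<open>\<delta>\<^sub>z\<close> vanished on the latter, then \<open>z\<close> would be a
  zero of a continuous function \<open>f\<close> on \<open>\<beta>X\<close> that is positive on \<open>X\<close>, and the functions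
  \<open>n max(0, 1 - n f)\<close> would form a sequence that converges to \<open>0\<close> in \<open>C\<^sub>p\<^sup>b(X)\<close> with unbounded
  values at \<open>z\<close> (\<open>vanishing_imp_unbounded_compact\<close>). So every \<open>h\<^sub>y\<close> extends to \<open>X \<union> {z}\<close>. For
  discrete \<open>Y\<close> the values at \<open>z\<close> trivially form an element of \<open>C\<^sub>p(Y)\<close>. For locally compact \<open>Y\<close>
  the numerator and the denominator depend continuously on \<open>y\<close> as elements of \<open>C\<^sub>p\<^sup>b(X)\<close>, hence map
  compact sets to compact sets, and the continuity of \<open>\<delta>\<^sub>z\<close> on those makes the value at \<open>z\<close> continuous
  in \<open>y\<close> on compact subsets of \<open>Y\<close>, hence on \<open>Y\<close>. In both cases \<open>z \<in> T\<close> by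
  \<open>extended_value_imp_mem\<close>.

  Necessity. Both parts exhibit a subspace of \<open>\<beta>X\<close> that contains \<open>X\<close> and is homeomorphic to a closed
  subspace of a suitable \<open>C\<^sub>p(Y)\<close>, by \<open>quotient_graph_closed_in_Cp\<close>. For \<open>\<upsilon>X\<close> it is the complement of
  the zero set of a continuous function on \<open>\<beta>X\<close> without zeros in \<open>X\<close>, so a continuous function on
  \<open>\<beta>X\<close> that vanishes at \<open>z \<in> \<upsilon>X\<close> also vanishes somewhere on \<open>X\<close>. Consequently the values at \<open>z\<close> of
  countably many bounded functions are attained simultaneously at one \<open>x \<in> X\<close>, and evaluation at \<open>x\<close>
  is bounded on compact sets. For \<open>\<kappa>X\<close> it is the set of all \<open>w\<close> for which \<open>\<delta>\<^sub>w\<close> is continuous on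
  compact sets, with \<open>Y\<close> the topological sum of the compact subsets of \<open>C\<^sub>p\<^sup>b(X)\<close>.
\<close>

section \<open>The functionals \<open>\<delta>\<^sub>z\<close>\<close>

lemma delta_extends:
  assumes "f \<in> topspace (Cpb X)"
  shows "continuous_map (stone_cech X) euclideanreal (\<lambda>w. delta X w f)"
    and "\<And>x. x \<in> topspace X \<Longrightarrow> delta X (sc_map X x) f = f x"
proof -
  have f: "continuous_map X euclideanreal f" "bounded (f ` topspace X)"
    using assms by (auto simp: topspace_Cpb)
  have *: "continuous_map (stone_cech X) euclideanreal (sc_extension X f) \<and>
      (\<forall>x \<in> topspace X. sc_extension X f (sc_map X x) = f x)"
    using theI' [OF sc_extension_unique [OF f]] unfolding sc_extension_def by blast
  then show "continuous_map (stone_cech X) euclideanreal (\<lambda>w. delta X w f)"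
    by (simp add: delta_def)
  show "delta X (sc_map X x) f = f x" if "x \<in> topspace X" for x
    using * that by (simp add: delta_def)
qed

lemma delta_eqI:
  assumes "f \<in> topspace (Cpb X)" and "continuous_map (stone_cech X) euclideanreal g"
    and "\<And>x. x \<in> topspace X \<Longrightarrow> g (sc_map X x) = f x" and "w \<in> topspace (stone_cech X)"
  shows "delta X w f = g w"
proof (rule forall_in_closure_of_eq [of w "stone_cech X" "sc_map X ` topspace X" euclideanreal])
  show "w \<in> stone_cech X closure_of sc_map X ` topspace X"
    using assms(4) by (simp add: stone_cech_dense)
qed (use assms delta_extends in auto)

lemma continuous_map_sc_map:
  "tychonoff_space X \<Longrightarrow> continuous_map X (stone_cech X) (sc_map X)"
  using embedding_map_sc_map homeomorphic_imp_continuous_map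
  by (fastforce simp: embedding_map_def continuous_map_in_subtopology)

lemma restrict_stone_cech_in_Cpb:
  assumes "tychonoff_space X" and g: "continuous_map (stone_cech X) euclideanreal g"
  shows "(\<lambda>x\<in>topspace X. g (sc_map X x)) \<in> topspace (Cpb X)"
proof -
  have "continuous_map X euclideanreal (\<lambda>x. g (sc_map X x))"
    using continuous_map_compose [OF continuous_map_sc_map g] assms(1) by (simp add: o_def)
  then have "continuous_map X euclideanreal (\<lambda>x\<in>topspace X. g (sc_map X x))"
    by (rule continuous_map_eq) auto
  moreover have "compact (g ` topspace (stone_cech X))"
    using image_compactin [OF _ g] compact_space_stone_cech [of X]
    by (force simp: compact_space_def)
  then have "bounded ((\<lambda>x\<in>topspace X. g (sc_map X x)) ` topspace X)"
    by (rule bounded_subset [OF compact_imp_bounded]) (auto simp: sc_map_in_stone_cech)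
  ultimately show ?thesis
    by (simp add: topspace_Cpb)
qed

lemma unit_functions_subset_Cpb: "unit_functions X \<subseteq> topspace (Cpb X)"
  by (auto simp: unit_functions_def topspace_Cpb continuous_map_in_subtopology
      intro: bounded_subset [OF bounded_closed_interval])

lemma stone_cech_eq_subtopology:
  "stone_cech X = subtopology (real_power (unit_functions X)) (topspace (stone_cech X))"
proof -
  let ?P = "real_power (unit_functions X)"
  have "product_topology (\<lambda>_. top_of_set {0..1}) (unit_functions X) =
      subtopology ?P (\<Pi>\<^sub>E f\<in>unit_functions X. {0..1})"
    by (rule subtopology_product_topology [symmetric])
  then obtain W where "stone_cech X = subtopology ?P W"
    by (auto simp: stone_cech_def Let_def subtopology_subtopology)
  then show ?thesis
    by (metis subtopology_restrict topspace_subtopology)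
qed

lemma topspace_stone_cech_subset:
  "topspace (stone_cech X) \<subseteq> topspace (real_power (unit_functions X))"
  by (subst stone_cech_eq_subtopology) simp

lemma closedin_stone_cech:
  "closedin (real_power (unit_functions X)) (topspace (stone_cech X))"
proof (rule compactin_imp_closedin)
  show "compactin (real_power (unit_functions X)) (topspace (stone_cech X))"
    using compact_space_stone_cech [of X] topspace_stone_cech_subset
    by (metis compact_space_def compactin_subtopology stone_cech_eq_subtopology)
qed (simp add: Hausdorff_space_product_topology)

lemma continuous_map_stone_cech_coordinate:
  assumes "u \<in> unit_functions X"
  shows "continuous_map (stone_cech X) euclideanreal (\<lambda>w. w u)"
  by (subst stone_cech_eq_subtopology)
    (intro continuous_map_from_subtopology continuous_map_product_projection assms)

lemma delta_unit_function:
  assumes "u \<in> unit_functions X" "w \<in> topspace (stone_cech X)"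
  shows "delta X w u = w u"
  using assms unit_functions_subset_Cpb continuous_map_stone_cech_coordinate
  by (intro delta_eqI) (auto simp: sc_map_def)

section \<open>Maps into spaces of functions\<close>

lemma continuous_map_Cpb_eval:
  assumes "x \<in> topspace X"
  shows "continuous_map (Cpb X) euclideanreal (\<lambda>f. f x)"
  unfolding Cpb_def Cp_def
  by (intro continuous_map_from_subtopology continuous_map_product_projection assms)

lemma continuous_map_Cp_eval:
  assumes "x \<in> topspace X"
  shows "continuous_map (Cp X) euclideanreal (\<lambda>f. f x)"
  unfolding Cp_def
  by (intro continuous_map_from_subtopology continuous_map_product_projection assms)

lemma continuous_map_into_Cp:
  "continuous_map Z (Cp Y) g \<longleftrightarrow>
     g ` topspace Z \<subseteq> topspace (Cp Y) \<and>
     (\<forall>y\<in>topspace Y. continuous_map Z euclideanreal (\<lambda>z. g z y))"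
  unfolding topspace_Cp unfolding Cp_def continuous_map_in_subtopology continuous_map_componentwise
  by auto

lemma continuous_map_into_Cpb:
  "continuous_map Z (Cpb Y) g \<longleftrightarrow>
     g ` topspace Z \<subseteq> topspace (Cpb Y) \<and>
     (\<forall>y\<in>topspace Y. continuous_map Z euclideanreal (\<lambda>z. g z y))"
  unfolding topspace_Cpb
  unfolding Cpb_def continuous_map_in_subtopology continuous_map_into_Cp topspace_Cp
  by auto

lemma Cp_discrete_topology: "Cp (discrete_topology I) = real_power I"
proof -
  have "{f. continuous_map (discrete_topology I) euclideanreal f} = UNIV"
    by (simp add: continuous_map_def)
  then show ?thesis
    unfolding Cp_def topspace_discrete_topology by (simp only: subtopology_UNIV)
qed

section \<open>Subspaces of \<open>\<beta>X\<close> embedded as closed sets of functions\<close>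

text \<open>A family of quotients \<open>b\<^sub>t / a\<^sub>t\<close> of continuous functions on \<open>\<beta>X\<close>, indexed by a space \<open>Y\<close>, maps the
  set \<open>T\<close> of the points \<open>w\<close> at which all quotients are defined and depend continuously on \<open>t\<close> into
  \<open>C\<^sub>p(Y)\<close>. If all coordinates of \<open>\<beta>X\<close> are among the quotients, then this is an embedding with closed
  image: \<open>w\<close> is recovered continuously from its image \<open>p\<close>, and the image is given by the closed
  conditions \<open>w \<in> \<beta>X\<close> and \<open>a\<^sub>t(w) p(t) = b\<^sub>t(w)\<close>. As \<open>a\<^sub>t\<close> and \<open>b\<^sub>t\<close> have no common zero, these
  conditions already force \<open>a\<^sub>t(w) \<noteq> 0\<close>.\<close>

lemma quotient_graph_closed_in_Cp:
  fixes X :: "'a topology" and Y :: "'c topology" and e :: "('a \<Rightarrow> real) \<Rightarrow> 'c"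
    and a b :: "'c \<Rightarrow> (('a \<Rightarrow> real) \<Rightarrow> real) \<Rightarrow> real"
  defines "B \<equiv> stone_cech X"
  defines "h \<equiv> \<lambda>w. \<lambda>t\<in>topspace Y. b t w / a t w"
  assumes a: "\<And>t. t \<in> topspace Y \<Longrightarrow> continuous_map B euclideanreal (a t)"
    and b: "\<And>t. t \<in> topspace Y \<Longrightarrow> continuous_map B euclideanreal (b t)"
    and ab: "\<And>t w. t \<in> topspace Y \<Longrightarrow> w \<in> topspace B \<Longrightarrow> a t w = 0 \<Longrightarrow> b t w \<noteq> 0"
    and e: "\<And>u. u \<in> unit_functions X \<Longrightarrow> e u \<in> topspace Y"
    and eu: "\<And>u w. u \<in> unit_functions X \<Longrightarrow> w \<in> topspace B \<Longrightarrow> b (e u) w / a (e u) w = w u"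
    and T: "T = {w \<in> topspace B. (\<forall>t\<in>topspace Y. a t w \<noteq> 0) \<and> h w \<in> topspace (Cp Y)}"
  shows "\<exists>F. closedin (Cp Y) F \<and> subtopology B T homeomorphic_space subtopology (Cp Y) F"
proof -
  let ?P = "real_power (unit_functions X)"
  \<comment> \<open>\<open>q p\<close> collects the entries of \<open>p\<close> that are to be the coordinates of a point of \<open>\<beta>X\<close>.\<close>
  define q where "q = (\<lambda>p. \<lambda>u\<in>unit_functions X. p (e u) :: real)"
  define F1 where "F1 = {p \<in> topspace (Cp Y). q p \<in> topspace B}"
  define F where "F = {p \<in> F1. \<forall>t\<in>topspace Y. a t (q p) * p t = b t (q p)}"
  have cq: "continuous_map (Cp Y) ?P q"
    unfolding q_def continuous_map_componentwise using e by (auto intro: continuous_map_Cp_eval)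
  have clF1: "closedin (Cp Y) F1"
    unfolding F1_def B_def by (rule closedin_continuous_map_preimage [OF cq closedin_stone_cech])
  have cq1: "continuous_map (subtopology (Cp Y) F1) B q"
    unfolding B_def
    by (subst stone_cech_eq_subtopology)
      (use cq in \<open>auto simp: continuous_map_in_subtopology F1_def B_def
        intro: continuous_map_from_subtopology\<close>)
  have F1top: "topspace (subtopology (Cp Y) F1) = F1"
    by (auto simp: F1_def)
  have "closedin (subtopology (Cp Y) F1)
      (topspace (subtopology (Cp Y) F1) \<inter>
        \<Inter>((\<lambda>t. {p \<in> topspace (subtopology (Cp Y) F1). a t (q p) * p t = b t (q p)}) ` topspace Y))"
  proof (cases "topspace Y = {}")
    case False
    have "closedin (subtopology (Cp Y) F1)
        {p \<in> topspace (subtopology (Cp Y) F1). a t (q p) * p t = b t (q p)}"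
      if t: "t \<in> topspace Y" for t
    proof (rule closedin_continuous_maps_eq)
      show "continuous_map (subtopology (Cp Y) F1) euclideanreal (\<lambda>p. a t (q p) * p t)"
        using continuous_map_compose [OF cq1 a[OF t]]
          continuous_map_from_subtopology [OF continuous_map_Cp_eval [OF t]]
        by (intro continuous_intros) (auto simp: o_def)
      show "continuous_map (subtopology (Cp Y) F1) euclideanreal (\<lambda>p. b t (q p))"
        using continuous_map_compose [OF cq1 b[OF t]] by (simp add: o_def)
    qed simp
    then show ?thesis
      using False by (intro closedin_Int closedin_topspace closedin_Inter) blast+
  qed (use closedin_topspace [of "subtopology (Cp Y) F1"] in simp)
  also have "topspace (subtopology (Cp Y) F1) \<inter>
      \<Inter>((\<lambda>t. {p \<in> topspace (subtopology (Cp Y) F1). a t (q p) * p t = b t (q p)}) ` topspace Y) = F"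
    unfolding F1top F_def by auto
  finally have clF: "closedin (Cp Y) F"
    using clF1 closedin_trans_full by blast
  have qh: "q (h w) = w" if "w \<in> topspace B" for w
  proof -
    have "w \<in> extensional (unit_functions X)"
      using that topspace_stone_cech_subset [of X] by (auto simp: B_def PiE_def)
    then show ?thesis
      using that e eu by (auto simp: q_def h_def fun_eq_iff extensional_def)
  qed
  have hF: "h w \<in> F" if "w \<in> T" for w
    using that qh by (auto simp: T F_def F1_def) (simp add: h_def)
  have hq: "h (q p) = p" and qT: "q p \<in> T" if "p \<in> F" for p
  proof -
    have p: "p \<in> topspace (Cp Y)" "q p \<in> topspace B"
        "\<And>t. t \<in> topspace Y \<Longrightarrow> a t (q p) * p t = b t (q p)"
      using that by (auto simp: F_def F1_def)
    have nz: "a t (q p) \<noteq> 0" if "t \<in> topspace Y" for t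
      using ab[OF that p(2)] p(3)[OF that] by auto
    have "h (q p) t = p t" for t
      using nz[of t] p(1) p(3)[of t]
      by (auto simp: h_def topspace_Cp extensional_def field_simps)
    then show *: "h (q p) = p" by blast
    show "q p \<in> T"
      using p nz * by (auto simp: T)
  qed
  have "homeomorphic_maps (subtopology B T) (subtopology (Cp Y) F) h q"
    unfolding homeomorphic_maps_def
  proof (intro conjI ballI)
    have "continuous_map (subtopology B T) euclideanreal (\<lambda>w. h w t)" if t: "t \<in> topspace Y" for t
    proof -
      have "continuous_map (subtopology B T) euclideanreal (\<lambda>w. b t w / a t w)"
        using a[OF t] b[OF t] t
        by (intro continuous_map_real_divide continuous_map_from_subtopology) (auto simp: T)
      then show ?thesis
        using t by (simp add: h_def)
    qed
    then show "continuous_map (subtopology B T) (subtopology (Cp Y) F) h"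
      using hF by (auto simp: continuous_map_in_subtopology continuous_map_into_Cp T)
    have "continuous_map (subtopology (Cp Y) F) B q"
      by (rule continuous_map_from_subtopology_mono [OF cq1]) (auto simp: F_def)
    then show "continuous_map (subtopology (Cp Y) F) (subtopology B T) q"
      using qT by (auto simp: continuous_map_in_subtopology)
  qed (use qh hq clF closedin_subset in \<open>auto simp: T\<close>)
  then show ?thesis
    using clF unfolding homeomorphic_space_def by blast
qed

section \<open>Continuous functions on \<open>\<beta>X\<close> that vanish at a point\<close>

lemma vanishing_imp_unbounded_compact:
  assumes X: "tychonoff_space X" and z: "z \<in> topspace (stone_cech X)"
    and f: "continuous_map (stone_cech X) euclideanreal f" "f z = 0"
    and pos: "\<And>x. x \<in> topspace X \<Longrightarrow> f (sc_map X x) > 0"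
  shows "\<exists>K. compactin (Cpb X) K \<and> \<not> bounded (delta X z ` K)"
proof -
  define G where "G = (\<lambda>n w. real n * max 0 (1 - real n * f w))"
  define g where "g = (\<lambda>n. \<lambda>x\<in>topspace X. G n (sc_map X x))"
  define l where "l = (\<lambda>x\<in>topspace X. 0::real)"
  have cG: "continuous_map (stone_cech X) euclideanreal (G n)" for n
    unfolding G_def using f(1) by (intro continuous_intros) auto
  have g: "g n \<in> topspace (Cpb X)" for n
    unfolding g_def by (rule restrict_stone_cech_in_Cpb [OF X cG])
  have l: "l \<in> topspace (Cpb X)"
    unfolding l_def by (rule restrict_stone_cech_in_Cpb [OF X]) simp
  have "limitin (real_power (topspace X)) g l sequentially"
    unfolding limitin_componentwise
  proof (intro conjI ballI)
    fix x assume x: "x \<in> topspace X"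
    have "eventually (\<lambda>n. g n x = 0) sequentially"
    proof -
      obtain N :: nat where N: "1 / f (sc_map X x) < real N"
        using reals_Archimedean2 by blast
      have "g n x = 0" if "n \<ge> N" for n
      proof -
        have "1 \<le> real n * f (sc_map X x)"
          using N that pos[OF x] by (simp add: divide_less_eq)
            (smt (verit) mult_right_mono of_nat_mono)
        then show ?thesis
          using x by (simp add: g_def G_def)
      qed
      then show ?thesis
        by (auto simp: eventually_sequentially)
    qed
    then show "limitin euclideanreal (\<lambda>n. g n x) (l x) sequentially"
      using x by (intro limitin_eventually) (auto simp: l_def)
  qed (auto simp: l_def g_def)
  then have "limitin (Cpb X) g l sequentially"
    using g l by (auto simp: Cpb_def Cp_def limitin_subtopology)
  then have "compactin (Cpb X) (insert l (range g))"
    by (rule compactin_sequence_with_limit) (use g in auto)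
  moreover have "\<not> bounded (delta X z ` insert l (range g))"
  proof
    assume "bounded (delta X z ` insert l (range g))"
    then obtain M where M: "\<And>n. \<bar>delta X z (g n)\<bar> \<le> M"
      by (auto simp: bounded_iff)
    have "delta X z (g n) = real n" for n
    proof -
      have "delta X z (g n) = G n z"
        by (rule delta_eqI [OF g cG _ z]) (simp add: g_def)
      then show ?thesis
        using f(2) by (simp add: G_def)
    qed
    then have "real n \<le> M" for n
      using M[of n] by simp
    then show False
      using reals_Archimedean2 not_le by blast
  qed
  ultimately show ?thesis by blast
qed

lemma realcompactification_vanishing:
  fixes X :: "'a topology"
  assumes z: "z \<in> realcompactification X" and zB: "z \<in> topspace (stone_cech X)"
    and f: "continuous_map (stone_cech X) euclideanreal f" "f z = 0"
  shows "\<exists>x\<in>topspace X. f (sc_map X x) = 0"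
proof (rule ccontr)
  assume nz: "\<not> (\<exists>x\<in>topspace X. f (sc_map X x) = 0)"
  define T where "T = {w \<in> topspace (stone_cech X). f w \<noteq> 0}"
  \<comment> \<open>The index \<open>None\<close> stands for the quotient \<open>1 / f\<close>, the others for the coordinates of \<open>\<beta>X\<close>.\<close>
  define I where "I = insert None (Some ` unit_functions X)"
  define a :: "('a \<Rightarrow> real) option \<Rightarrow> (('a \<Rightarrow> real) \<Rightarrow> real) \<Rightarrow> real"
    where "a = (\<lambda>t w. case t of None \<Rightarrow> f w | Some u \<Rightarrow> 1)"
  define b :: "('a \<Rightarrow> real) option \<Rightarrow> (('a \<Rightarrow> real) \<Rightarrow> real) \<Rightarrow> real"
    where "b = (\<lambda>t w. case t of None \<Rightarrow> 1 | Some u \<Rightarrow> w u)"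
  have "\<exists>F. closedin (Cp (discrete_topology I)) F \<and>
      subtopology (stone_cech X) T homeomorphic_space subtopology (Cp (discrete_topology I)) F"
  proof (rule quotient_graph_closed_in_Cp [where a = a and b = b and e = Some])
    \<comment> \<open>On a discrete space every function is continuous, so only the domain \<open>f w \<noteq> 0\<close> of \<open>1 / f\<close> matters.\<close>
    show "T = {w \<in> topspace (stone_cech X). (\<forall>t\<in>topspace (discrete_topology I). a t w \<noteq> 0) \<and>
        (\<lambda>t\<in>topspace (discrete_topology I). b t w / a t w) \<in> topspace (Cp (discrete_topology I))}"
      unfolding Cp_discrete_topology by (auto simp: T_def I_def a_def)
  qed (auto simp: I_def a_def b_def f(1) continuous_map_stone_cech_coordinate)
  then have "realcompact_space (subtopology (stone_cech X) T)"
    unfolding Cp_discrete_topology using realcompact_spaceI by blast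
  moreover have "sc_map X ` topspace X \<subseteq> T"
    using nz sc_map_in_stone_cech by (auto simp: T_def)
  ultimately have "z \<in> T"
    using z unfolding realcompactification_def by (auto simp: T_def)
  then show False
    using f(2) by (simp add: T_def)
qed

text \<open>The series \<open>\<Sum>\<^sub>n 2\<^sup>-\<^sup>n min(1, \<bar>\<delta>\<^sub>w(f\<^sub>n) - \<delta>\<^sub>z(f\<^sub>n)\<bar>)\<close> is continuous in \<open>w\<close> and vanishes at \<open>z\<close>, hence
  it vanishes at a point of \<open>X\<close>.\<close>

lemma realcompactification_simultaneous_values:
  fixes f :: "nat \<Rightarrow> 'a \<Rightarrow> real"
  assumes z: "z \<in> realcompactification X" and zB: "z \<in> topspace (stone_cech X)"
    and f: "\<And>n. f n \<in> topspace (Cpb X)"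
  shows "\<exists>x\<in>topspace X. \<forall>n. f n x = delta X z (f n)"
proof -
  define d where "d = (\<lambda>n w. (1/2)^n * min 1 \<bar>delta X w (f n) - delta X z (f n)\<bar>)"
  have bd: "\<bar>d n w\<bar> \<le> (1/2)^n" for n w
    by (simp add: d_def abs_mult mult_le_cancel_left1)
  have sm: "summable (\<lambda>n. d n w)" for w
    using summable_rabs_comparison_test [of "\<lambda>n. d n w" "\<lambda>n. (1/2)^n"] bd
      summable_geometric [of "1/2::real"] summable_rabs_cancel by fastforce
  have cd: "continuous_map (stone_cech X) euclideanreal (d n)" for n
    unfolding d_def using delta_extends(1) [OF f] by (intro continuous_intros) auto
  have "uniform_limit (topspace (stone_cech X)) (\<lambda>n w. \<Sum>i<n. d i w) (\<lambda>w. \<Sum>i. d i w) sequentially"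
    by (rule Weierstrass_m_test [where M = "\<lambda>n. (1/2)^n"]) (use bd summable_geometric [of "1/2::real"] in auto)
  then have "continuous_map (stone_cech X) Met_TC.mtopology (\<lambda>w. \<Sum>i. d i w)"
  proof (intro Met_TC.continuous_map_uniform_limit [where F = sequentially and f = "\<lambda>n w. \<Sum>i<n. d i w"])
    show "\<forall>\<^sub>F n in sequentially. continuous_map (stone_cech X) Met_TC.mtopology (\<lambda>w. \<Sum>i<n. d i w)"
      using cd by (auto intro!: always_eventually continuous_map_sum)
  qed (auto simp: uniform_limit_iff)
  then have c: "continuous_map (stone_cech X) euclideanreal (\<lambda>w. \<Sum>i. d i w)"
    by simp
  have "(\<Sum>i. d i z) = 0"
    by (simp add: d_def)
  then obtain x where x: "x \<in> topspace X" "(\<Sum>i. d i (sc_map X x)) = 0"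
    using realcompactification_vanishing [OF z zB c] by auto
  have "f n x = delta X z (f n)" for n
  proof -
    have "d n (sc_map X x) = 0"
      using x(2) suminf_eq_zero_iff [OF sm] by (simp add: d_def)
    then show ?thesis
      using delta_extends(2) [OF f x(1), of n] by (simp add: d_def min_def split: if_splits)
  qed
  then show ?thesis
    using x(1) by blast
qed

section \<open>Extending an embedding to a further point of \<open>\<beta>X\<close>\<close>

text \<open>Here the roles of the variables are exchanged: a continuous map \<open>h\<close> from \<open>X\<close> to \<open>C\<^sub>p(Y)\<close> is
  separately continuous on \<open>X \<times> Y\<close>, which is symmetric in \<open>X\<close> and \<open>Y\<close>. The bounded function \<open>\<phi>\<close>
  makes the functions on \<open>X\<close> bounded.\<close>

lemma continuous_map_postcompose_into_Cpb:
  assumes X: "tychonoff_space X" and h: "continuous_map X (Cp Y) h"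
    and \<phi>: "continuous_on UNIV \<phi>" "bounded (range \<phi>)"
  shows "continuous_map Y (Cpb X) (\<lambda>y. \<lambda>x\<in>topspace X. \<phi> (h x y :: real) :: real)"
  unfolding continuous_map_into_Cpb
proof (intro conjI ballI)
  have c\<phi>: "continuous_map euclideanreal euclideanreal \<phi>"
    using \<phi>(1) by simp
  have "(\<lambda>x\<in>topspace X. \<phi> (h x y)) \<in> topspace (Cpb X)" if "y \<in> topspace Y" for y
  proof -
    have "continuous_map X euclideanreal (\<lambda>x. h x y)"
      using h that by (simp add: continuous_map_into_Cp)
    then have "continuous_map X euclideanreal (\<lambda>x. \<phi> (h x y))"
      using continuous_map_compose [OF _ c\<phi>] by (force simp: o_def)
    then have "continuous_map X euclideanreal (\<lambda>x\<in>topspace X. \<phi> (h x y))"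
      by (rule continuous_map_eq) auto
    then show ?thesis
      by (auto simp: topspace_Cpb intro: bounded_subset [OF \<phi>(2)])
  qed
  then show "(\<lambda>y. \<lambda>x\<in>topspace X. \<phi> (h x y)) ` topspace Y \<subseteq> topspace (Cpb X)"
    by blast
  fix x assume x: "x \<in> topspace X"
  have "continuous_map Y euclideanreal (h x)"
    using h x unfolding continuous_map_into_Cp topspace_Cp by blast
  then show "continuous_map Y euclideanreal (\<lambda>y. (\<lambda>x\<in>topspace X. \<phi> (h x y)) x)"
    using continuous_map_compose [OF _ c\<phi>, of Y "h x"] x by (simp add: o_def)
qed

text \<open>A family \<open>h\<close> of real-valued functions on \<open>X\<close>, indexed by \<open>y\<close>, is written as a quotient of two
  families of bounded functions.\<close>

definition numer :: "'a topology \<Rightarrow> ('a \<Rightarrow> 'c \<Rightarrow> real) \<Rightarrow> 'c \<Rightarrow> 'a \<Rightarrow> real" where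
  "numer X h = (\<lambda>y. \<lambda>x\<in>topspace X. h x y / (1 + \<bar>h x y\<bar>))"

text \<open>The denominator that belongs to \<open>numer\<close>; it is positive everywhere on \<open>X\<close>.\<close>

definition denom :: "'a topology \<Rightarrow> ('a \<Rightarrow> 'c \<Rightarrow> real) \<Rightarrow> 'c \<Rightarrow> 'a \<Rightarrow> real" where
  "denom X h = (\<lambda>y. \<lambda>x\<in>topspace X. 1 / (1 + \<bar>h x y\<bar>))"

lemma continuous_map_numer:
  assumes "tychonoff_space X" "continuous_map X (Cp Y) h"
  shows "continuous_map Y (Cpb X) (numer X h)"
  unfolding numer_def
proof (rule continuous_map_postcompose_into_Cpb [OF assms])
  show "continuous_on UNIV (\<lambda>t::real. t / (1 + \<bar>t\<bar>))"
    by (intro continuous_intros) auto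
  show "bounded (range (\<lambda>t::real. t / (1 + \<bar>t\<bar>)))"
    unfolding bounded_iff by (rule exI [of _ 1]) auto
qed

lemma continuous_map_denom:
  assumes "tychonoff_space X" "continuous_map X (Cp Y) h"
  shows "continuous_map Y (Cpb X) (denom X h)"
  unfolding denom_def
proof (rule continuous_map_postcompose_into_Cpb [OF assms])
  show "continuous_on UNIV (\<lambda>t::real. 1 / (1 + \<bar>t\<bar>))"
    by (intro continuous_intros) auto
  show "bounded (range (\<lambda>t::real. 1 / (1 + \<bar>t\<bar>)))"
    unfolding bounded_iff by (rule exI [of _ 1]) auto
qed

lemma continuous_map_homeomorphic_maps_sc_map:
  assumes "tychonoff_space X" "sc_map X ` topspace X \<subseteq> T"
    and "homeomorphic_maps (subtopology (stone_cech X) T) (subtopology Z F) h k"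
  shows "continuous_map X Z (h \<circ> sc_map X)"
proof (rule continuous_map_compose)
  show "continuous_map X (subtopology (stone_cech X) T) (sc_map X)"
    using assms(2) continuous_map_sc_map [OF assms(1)]
    by (simp add: continuous_map_in_subtopology image_subset_iff_funcset)
  show "continuous_map (subtopology (stone_cech X) T) Z h"
    using assms(3) by (simp add: homeomorphic_maps_def continuous_map_in_subtopology)
qed

text \<open>Write \<open>h y\<close> for the function \<open>x \<mapsto> h x y\<close> on \<open>X\<close>, so that \<open>h y = numer y / denom y\<close>. When
  \<open>\<delta>\<^sub>z (denom y)\<close> never vanishes, each \<open>h y\<close> extends continuously to \<open>X \<union> {z}\<close>, with the quotient
  \<open>\<delta>\<^sub>z (numer y) / \<delta>\<^sub>z (denom y)\<close> as its value at \<open>z\<close>. If these values depend continuously on \<open>y\<close>,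
  then they form a point of \<open>F\<close>, because \<open>F\<close> is closed, and the inverse homeomorphism sends that
  point to \<open>z\<close>.\<close>

lemma extended_value_imp_mem:
  assumes X: "tychonoff_space X" and z: "z \<in> topspace (stone_cech X)"
    and T: "sc_map X ` topspace X \<subseteq> T" "T \<subseteq> topspace (stone_cech X)"
    and cl: "closedin (Cp Y) F"
    and hk: "homeomorphic_maps (subtopology (stone_cech X) T) (subtopology (Cp Y) F) h k"
    and nz: "\<And>y. y \<in> topspace Y \<Longrightarrow> delta X z (denom X (h \<circ> sc_map X) y) \<noteq> 0"
    and dz: "(\<lambda>y\<in>topspace Y. delta X z (numer X (h \<circ> sc_map X) y) /
        delta X z (denom X (h \<circ> sc_map X) y)) \<in> topspace (Cp Y)"
  shows "z \<in> T"
proof -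
  let ?B = "stone_cech X" and ?S = "sc_map X ` topspace X"
  let ?D = "subtopology (stone_cech X) (insert z ?S)"
  define h' where "h' = h \<circ> sc_map X"
  define H where
    "H = (\<lambda>w. \<lambda>y\<in>topspace Y. delta X w (numer X h' y) / delta X w (denom X h' y))"
  have hF: "\<And>w. w \<in> T \<Longrightarrow> h w \<in> F"
    and ck: "continuous_map (subtopology (Cp Y) F) (subtopology ?B T) k"
    and kh: "\<And>w. w \<in> T \<Longrightarrow> k (h w) = w"
    using hk T(2) closedin_subset [OF cl]
    by (auto simp: homeomorphic_maps_def continuous_map_in_subtopology)
  have ch': "continuous_map X (Cp Y) h'"
    unfolding h'_def by (rule continuous_map_homeomorphic_maps_sc_map [OF X T(1) hk])
  have nd: "numer X h' y \<in> topspace (Cpb X)" "denom X h' y \<in> topspace (Cpb X)" if "y \<in> topspace Y" for y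
    using continuous_map_numer [OF X ch'] continuous_map_denom [OF X ch'] that
    by (auto simp: continuous_map_def)
  have SB: "insert z ?S \<subseteq> topspace ?B"
    using z sc_map_in_stone_cech by auto
  have HS: "H (sc_map X x) = h' x" if "x \<in> topspace X" for x
  proof -
    have "h' x \<in> extensional (topspace Y)"
      using ch' that unfolding continuous_map_into_Cp topspace_Cp by blast
    then show ?thesis
      using that delta_extends(2) [OF nd(1) that] delta_extends(2) [OF nd(2) that]
      by (auto simp: H_def numer_def denom_def fun_eq_iff extensional_def)
  qed
  have nz': "delta X w (denom X h' y) \<noteq> 0" if "w \<in> insert z ?S" "y \<in> topspace Y" for w y
    using that nz[OF that(2)] delta_extends(2) [OF nd(2)[OF that(2)]]
    by (auto simp: h'_def) (auto simp: denom_def)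
  have cH: "continuous_map ?D (Cp Y) H"
    unfolding continuous_map_into_Cp
  proof (intro conjI ballI)
    show "H ` topspace ?D \<subseteq> topspace (Cp Y)"
      using HS dz ch' by (auto simp: H_def h'_def continuous_map_def)
    fix y assume y: "y \<in> topspace Y"
    have "continuous_map ?D euclideanreal (\<lambda>w. delta X w (numer X h' y) / delta X w (denom X h' y))"
      using nd[OF y] nz' y
      by (intro continuous_map_real_divide continuous_map_from_subtopology delta_extends(1)) auto
    then show "continuous_map ?D euclideanreal (\<lambda>w. H w y)"
      using y by (simp add: H_def)
  qed
  have dense: "?D closure_of ?S = topspace ?D"
    using SB Int_absorb1 [OF subset_insertI [of ?S z]]
    by (auto simp: closure_of_subtopology stone_cech_dense)
  have "H ` (?D closure_of ?S) \<subseteq> F"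
  proof -
    have "H ` ?S \<subseteq> F"
      using HS hF T(1) by (auto simp: h'_def)
    then have "Cp Y closure_of H ` ?S \<subseteq> F"
      using cl by (rule closure_of_minimal)
    then show ?thesis
      using continuous_map_image_closure_subset [OF cH] by blast
  qed
  then have "continuous_map ?D (subtopology (Cp Y) F) H"
    using cH by (auto simp: continuous_map_in_subtopology dense)
  then have ckH: "continuous_map ?D (subtopology ?B T) (k \<circ> H)"
    using ck by (rule continuous_map_compose)
  have zD: "z \<in> topspace ?D"
    using SB by simp
  \<comment> \<open>\<open>k \<circ> H\<close> is the identity on the dense set \<open>X\<close>, hence also at \<open>z\<close>.\<close>
  have "(k \<circ> H) z = id z"
  proof (rule forall_in_closure_of_eq [of z ?D ?S ?B])
    show "z \<in> ?D closure_of ?S" using zD dense by blast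
    show "continuous_map ?D ?B (k \<circ> H)" using ckH by (simp add: continuous_map_in_subtopology)
    show "continuous_map ?D ?B id" by (simp add: continuous_map_from_subtopology)
    show "(k \<circ> H) w = id w" if "w \<in> ?S" for w
      using that HS kh T(1) by (auto simp: h'_def)
  qed (rule Hausdorff_space_stone_cech)
  moreover have "(k \<circ> H) z \<in> T"
    using ckH zD by (auto simp: continuous_map_def)
  ultimately show ?thesis by simp
qed

lemma delta_denom_nonzero:
  assumes X: "tychonoff_space X" and z: "z \<in> topspace (stone_cech X)"
    and bd: "\<And>K. compactin (Cpb X) K \<Longrightarrow> bounded (delta X z ` K)"
    and h: "continuous_map X (Cp Y) h" and y: "y \<in> topspace Y"
  shows "delta X z (denom X h y) \<noteq> 0"
proof
  assume 0: "delta X z (denom X h y) = 0"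
  have d: "denom X h y \<in> topspace (Cpb X)"
    using continuous_map_denom [OF X h] y by (auto simp: continuous_map_def)
  have "\<exists>K. compactin (Cpb X) K \<and> \<not> bounded (delta X z ` K)"
  proof (rule vanishing_imp_unbounded_compact [where f = "\<lambda>w. delta X w (denom X h y)", OF X z])
    show "delta X (sc_map X x) (denom X h y) > 0" if "x \<in> topspace X" for x
      using that by (simp only: delta_extends(2) [OF d]) (simp add: denom_def)
  qed (use d 0 delta_extends(1) in auto)
  then show False
    using bd by blast
qed

section \<open>The two characterizations\<close>

theorem realcompactification_iff_bounded:
  assumes X: "tychonoff_space X" and z: "z \<in> topspace (stone_cech X)"
  shows "z \<in> realcompactification X \<longleftrightarrow>
           (\<forall>K. compactin (Cpb X) K \<longrightarrow> bounded (delta X z ` K))"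
proof (intro iffI allI impI)
  fix K assume zr: "z \<in> realcompactification X" and K: "compactin (Cpb X) K"
  show "bounded (delta X z ` K)"
  proof (rule ccontr)
    assume "\<not> bounded (delta X z ` K)"
    then have "\<forall>n::nat. \<exists>f\<in>K. \<bar>delta X z f\<bar> > real n"
      by (force simp: bounded_iff not_le)
    then obtain f where f: "\<And>n. f n \<in> K" "\<And>n. \<bar>delta X z (f n)\<bar> > real n"
      by metis
    have "f n \<in> topspace (Cpb X)" for n
      using f(1) compactin_subset_topspace [OF K] by blast
    then obtain x where x: "x \<in> topspace X" "\<And>n. f n x = delta X z (f n)"
      using realcompactification_simultaneous_values [OF zr z] by blast
    have "bounded ((\<lambda>g. g x) ` K)"
      using image_compactin [OF K continuous_map_Cpb_eval [OF x(1)]]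
      by (simp add: compact_imp_bounded)
    then obtain M where "\<And>n. \<bar>f n x\<bar> \<le> M"
      using f(1) by (auto simp: bounded_iff)
    then have "real n < M" for n
      using f(2)[of n] x(2)[of n] by (metis less_le_trans)
    then show False
      using reals_Archimedean2 less_asym by blast
  qed
next
  assume bd: "\<forall>K. compactin (Cpb X) K \<longrightarrow> bounded (delta X z ` K)"
  have "z \<in> T" if T: "sc_map X ` topspace X \<subseteq> T" "T \<subseteq> topspace (stone_cech X)"
    and rc: "realcompact_space (subtopology (stone_cech X) T)" for T
  proof -
    obtain I :: "((('a \<Rightarrow> real) \<Rightarrow> real) \<Rightarrow> real) set" and F h k where
      F: "closedin (real_power I) F"
      and hk: "homeomorphic_maps (subtopology (stone_cech X) T) (subtopology (real_power I) F) h k"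
      using rc unfolding realcompact_space_def homeomorphic_space_def by blast
    note F = F [folded Cp_discrete_topology] and hk = hk [folded Cp_discrete_topology]
    have ch: "continuous_map X (Cp (discrete_topology I)) (h \<circ> sc_map X)"
      by (rule continuous_map_homeomorphic_maps_sc_map [OF X T(1) hk])
    show ?thesis
    proof (rule extended_value_imp_mem [OF X z T F hk])
      show "delta X z (denom X (h \<circ> sc_map X) i) \<noteq> 0"
        if "i \<in> topspace (discrete_topology I)" for i
        by (rule delta_denom_nonzero [OF X z _ ch that]) (use bd in blast)
    qed (simp add: Cp_discrete_topology)
  qed
  then show "z \<in> realcompactification X"
    by (auto simp: realcompactification_def)
qed

theorem kappa_completion_iff_continuous:
  assumes X: "tychonoff_space X" and z: "z \<in> topspace (stone_cech X)"
  shows "z \<in> kappa_completion X \<longleftrightarrow>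
           (\<forall>K. compactin (Cpb X) K \<longrightarrow>
              continuous_map (subtopology (Cpb X) K) euclideanreal (delta X z))"
proof
  define \<K> where "\<K> = {K. compactin (Cpb X) K}"
  define T where "T = {w \<in> topspace (stone_cech X).
      \<forall>K\<in>\<K>. continuous_map (subtopology (Cpb X) K) euclideanreal (delta X w)}"
  \<comment> \<open>Singletons are compact, so \<open>Y\<close> has a point \<open>({u}, u)\<close> for every coordinate \<open>u\<close> of \<open>\<beta>X\<close>.\<close>
  define Y where "Y = sum_topology (subtopology (Cpb X)) \<K>"
  have Ksub: "K \<subseteq> topspace (Cpb X)" if "K \<in> \<K>" for K
    using that by (auto simp: \<K>_def compactin_subset_topspace)
  have Ytop: "topspace Y = Sigma \<K> (\<lambda>K. K)"
    using Ksub by (fastforce simp: Y_def)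
  have H: "Hausdorff_space (Cpb X)"
    by (simp add: Cpb_def Cp_def Hausdorff_space_subtopology Hausdorff_space_product_topology)
  have cont: "continuous_map Y euclideanreal (\<lambda>t. delta X w (snd t)) \<longleftrightarrow>
      (\<forall>K\<in>\<K>. continuous_map (subtopology (Cpb X) K) euclideanreal (delta X w))" for w
  proof (intro iffI ballI)
    fix K assume c: "continuous_map Y euclideanreal (\<lambda>t. delta X w (snd t))" and K: "K \<in> \<K>"
    show "continuous_map (subtopology (Cpb X) K) euclideanreal (delta X w)"
      using continuous_map_compose [OF continuous_map_component_injection [OF K, of "subtopology (Cpb X)"]
          c [unfolded Y_def]]
      by (simp add: o_def)
  qed (auto simp: Y_def intro: continuous_map_sum_topology)
  have "\<exists>F. closedin (Cp Y) F \<and>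
      subtopology (stone_cech X) T homeomorphic_space subtopology (Cp Y) F"
  proof (rule quotient_graph_closed_in_Cp
      [where a = "\<lambda>_ _. 1" and b = "\<lambda>t w. delta X w (snd t)" and e = "\<lambda>u. ({u}, u)"])
    show "continuous_map (stone_cech X) euclideanreal (\<lambda>w. delta X w (snd t))"
      if "t \<in> topspace Y" for t
      using that Ksub [of "fst t"] by (intro delta_extends(1)) (auto simp: Ytop)
    show "({u}, u) \<in> topspace Y" if "u \<in> unit_functions X" for u
      using that unit_functions_subset_Cpb by (auto simp: Ytop \<K>_def)
    have "continuous_map Y euclideanreal (\<lambda>t\<in>topspace Y. delta X w (snd t)) \<longleftrightarrow>
        continuous_map Y euclideanreal (\<lambda>t. delta X w (snd t))" for w
      by (auto elim: continuous_map_eq)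
    then show "T = {w \<in> topspace (stone_cech X). (\<forall>t\<in>topspace Y. (1::real) \<noteq> 0) \<and>
        (\<lambda>t\<in>topspace Y. delta X w (snd t) / 1) \<in> topspace (Cp Y)}"
      by (simp add: T_def topspace_Cp cont)
  qed (auto simp: delta_unit_function)
  moreover have "locally_compact_space Y"
    unfolding Y_def
    by (rule locally_compact_space_sum_topology) (auto simp: \<K>_def compact_space_subtopology)
  moreover have "Hausdorff_space Y"
    unfolding Y_def by (rule Hausdorff_space_sum_topology) (simp add: H Hausdorff_space_subtopology)
  ultimately have "kappa_space (subtopology (stone_cech X) T)"
    using kappa_spaceI by blast
  moreover have "sc_map X ` topspace X \<subseteq> T"
  proof clarify
    fix x assume x: "x \<in> topspace X"
    have "continuous_map (subtopology (Cpb X) K) euclideanreal (delta X (sc_map X x))" for K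
      by (rule continuous_map_eq
          [OF continuous_map_from_subtopology [OF continuous_map_Cpb_eval [OF x]]])
        (use x in \<open>simp add: delta_extends(2)\<close>)
    then show "sc_map X x \<in> T"
      using x by (simp add: T_def sc_map_in_stone_cech)
  qed
  moreover assume "z \<in> kappa_completion X"
  ultimately have "z \<in> T"
    unfolding kappa_completion_def by (auto simp: T_def)
  then show "\<forall>K. compactin (Cpb X) K \<longrightarrow>
      continuous_map (subtopology (Cpb X) K) euclideanreal (delta X z)"
    by (simp add: T_def \<K>_def)
next
  assume c: "\<forall>K. compactin (Cpb X) K \<longrightarrow>
      continuous_map (subtopology (Cpb X) K) euclideanreal (delta X z)"
  have bd: "bounded (delta X z ` K)" if K: "compactin (Cpb X) K" for K
  proof -
    have "compactin (subtopology (Cpb X) K) K"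
      using K by (simp add: compactin_subtopology)
    then show ?thesis
      using image_compactin [of _ K euclideanreal] c K compact_imp_bounded compactin_euclidean_iff by blast
  qed
  have "z \<in> T" if T: "sc_map X ` topspace X \<subseteq> T" "T \<subseteq> topspace (stone_cech X)"
    and kp: "kappa_space (subtopology (stone_cech X) T)" for T
  proof -
    obtain Y :: "(((('a \<Rightarrow> real) \<Rightarrow> real) \<Rightarrow> real) set \<times> ((('a \<Rightarrow> real) \<Rightarrow> real) \<Rightarrow> real)) topology"
      and F h k where lc: "locally_compact_space Y" and F: "closedin (Cp Y) F"
      and hk: "homeomorphic_maps (subtopology (stone_cech X) T) (subtopology (Cp Y) F) h k"
      using kp unfolding kappa_space_def homeomorphic_space_def by blast
    define h' where "h' = h \<circ> sc_map X"
    have ch: "continuous_map X (Cp Y) h'"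
      unfolding h'_def by (rule continuous_map_homeomorphic_maps_sc_map [OF X T(1) hk])
    have nz: "delta X z (denom X h' y) \<noteq> 0" if "y \<in> topspace Y" for y
      using delta_denom_nonzero [OF X z bd ch that] .
    have k: "continuous_map Y euclideanreal (\<lambda>y. delta X z (g y))"
      if g: "continuous_map Y (Cpb X) g" for g
    proof (rule continuous_map_from_k_space [OF locally_compact_imp_k_space [OF lc]])
      fix L assume L: "compactin Y L"
      have "continuous_map (subtopology Y L) (subtopology (Cpb X) (g ` L)) g"
        using g by (auto simp: continuous_map_in_subtopology continuous_map_from_subtopology)
      moreover have "continuous_map (subtopology (Cpb X) (g ` L)) euclideanreal (delta X z)"
        using c image_compactin [OF L g] by blast
      ultimately show "continuous_map (subtopology Y L) euclideanreal (\<lambda>y. delta X z (g y))"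
        using continuous_map_compose [of "subtopology Y L" "subtopology (Cpb X) (g ` L)" g]
        by (simp add: o_def)
    qed
    show ?thesis
    proof (rule extended_value_imp_mem [OF X z T F hk])
      show "delta X z (denom X (h \<circ> sc_map X) y) \<noteq> 0" if "y \<in> topspace Y" for y
        using nz[OF that] by (simp add: h'_def)
      have "continuous_map Y euclideanreal (\<lambda>y. delta X z (numer X h' y) / delta X z (denom X h' y))"
        using nz continuous_map_numer [OF X ch] continuous_map_denom [OF X ch]
        by (intro continuous_map_real_divide k) auto
      then have "continuous_map Y euclideanreal
          (\<lambda>y\<in>topspace Y. delta X z (numer X h' y) / delta X z (denom X h' y))"
        by (rule continuous_map_eq) auto
      then show "(\<lambda>y\<in>topspace Y. delta X z (numer X (h \<circ> sc_map X) y) /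
          delta X z (denom X (h \<circ> sc_map X) y)) \<in> topspace (Cp Y)"
        by (simp add: topspace_Cp h'_def)
    qed
  qed
  then show "z \<in> kappa_completion X"
    by (auto simp: kappa_completion_def)
qed

theorem theorem1p3:
  fixes X :: "'a topology" and z :: "('a \<Rightarrow> real) \<Rightarrow> real"
  assumes "tychonoff_space X" and "z \<in> topspace (stone_cech X)"
  shows "(z \<in> realcompactification X \<longleftrightarrow>
            (\<forall>K. compactin (Cpb X) K \<longrightarrow> bounded (delta X z ` K))) \<and>
         (z \<in> kappa_completion X \<longleftrightarrow>
            (\<forall>K. compactin (Cpb X) K \<longrightarrow>
               continuous_map (subtopology (Cpb X) K) euclideanreal (delta X z)))"
  using realcompactification_iff_bounded [OF assms] kappa_completion_iff_continuous [OF assms]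
  by blast

end
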